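(* Let $t\in\mathbb Q$, $t\neq0,\pm1,\pm2$, let $r\ge1$ be a natural number and let $t_r=C_r(t)$. There is a canonical ring isomorphism $\Phi_r:\mathcal R(t)\to\mathcal R(t_r)$ given by the conjugation $\Phi_r(X)=A^{-1}XA$, where $$A=\begin{pmatrix}1&-U_{r-1}(t)\\0&U_r(t)\end{pmatrix},$$ and for $X=[x_0\ x_1]\in\mathcal R(t)$, representing the sequence $\{x_n\}_{n\in\mathbb Z}$, $$U_r(t)\,\Phi_r(X)=\begin{pmatrix}x_r-t_rx_0&-x_0\\ x_0&x_r\end{pmatrix}.$$ In particular $\Phi_r(D_t^r)=D_{t_r}$ and $\Phi_r(XD_t^{kr})=\Phi_r(X)D_{t_r}^k$ for all $k\in\mathbb Z$.
   Context: For $t\in\mathbb Q$ let $D_t=\begin{pmatrix}0&-1\\1&t\end{pmatrix}$ and let $\mathcal R(t)$ be the ring of all $2\times2$ rational matrices commuting with $D_t$; its elements are the matrices $[x_0\ x_1]:=\begin{pmatrix}x_1-tx_0&-x_0\\ x_0&x_1\end{pmatrix}$, $x_0,x_1\in\mathbb Q$. The element $[x_0\ x_1]$ is identified with the two-sided sequence $\{x_n\}_{n\in\mathbb Z}$ given by $x_{n+1}=tx_n-x_{n-1}$. Chebyshev polynomials (in the normalization used here): second kind $U_0=0$, $U_1=1$, $U_{n+1}(t)=tU_n(t)-U_{n-1}(t)$; first kind $C_n(t)=\operatorname{tr}D_t^n$, i.e. $C_0=2$, $C_1(t)=t$, $C_{n+1}(t)=tC_n(t)-C_{n-1}(t)$.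 *)

theory Defs
  imports "Jordan_Normal_Form.Matrix" "HOL-Algebra.QuotRing" "HOL-Algebra.Subrings"
begin

definition mat2 :: "rat \<Rightarrow> rat \<Rightarrow> rat \<Rightarrow> rat \<Rightarrow> rat mat" where
  "mat2 a b c d = mat_of_rows_list 2 [[a, b], [c, d]]"

abbreviation M2 :: "rat mat ring" where
  "M2 \<equiv> ring_mat TYPE(rat) 2 ()"

definition Dmat :: "rat \<Rightarrow> rat mat" where
  "Dmat t = mat2 0 (-1) 1 t"

definition Rring :: "rat \<Rightarrow> rat mat ring" where
  "Rring t = M2\<lparr>carrier := {X \<in> carrier M2. X * Dmat t = Dmat t * X}\<rparr>"

definition seq_mat :: "rat \<Rightarrow> rat \<Rightarrow> rat \<Rightarrow> rat mat" where
  "seq_mat t x0 x1 = mat2 (x1 - t * x0) (- x0) x0 x1"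

text \<open>The identification of elements of \<open>Rring t\<close> with two-sided sequences, as a relation;
  it determines the sequence uniquely (\<open>represents_unique\<close> below).\<close>

definition represents :: "rat \<Rightarrow> rat mat \<Rightarrow> (int \<Rightarrow> rat) \<Rightarrow> bool" where
  "represents t X x \<longleftrightarrow> (\<forall>n. x (n + 1) = t * x n - x (n - 1)) \<and> X = seq_mat t (x 0) (x 1)"

fun chebU :: "nat \<Rightarrow> rat \<Rightarrow> rat" where
  "chebU 0 t = 0"
| "chebU (Suc 0) t = 1"
| "chebU (Suc (Suc n)) t = t * chebU (Suc n) t - chebU n t"

text \<open>\<open>chebC n t\<close> is the trace of the \<open>n\<close>-th power of \<open>Dmat t\<close>;
  for the recurrence see \<open>chebC_rec\<close> below.\<close>

definition chebC :: "nat \<Rightarrow> rat \<Rightarrow> rat" where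
  "chebC n t = (\<Sum>i<2. (Dmat t [^]\<^bsub>M2\<^esub> n) $$ (i, i))"

text \<open>Meaningful for \<open>r \<ge> 1\<close> only: the subtraction \<open>r - 1\<close> is truncated at \<open>r = 0\<close>.\<close>

definition Amat :: "rat \<Rightarrow> nat \<Rightarrow> rat mat" where
  "Amat t r = mat2 1 (- chebU (r - 1) t) 0 (chebU r t)"

text \<open>The inverse is the one in the monoid of \<open>2\<times>2\<close> matrices, unspecified unless \<open>Amat t r\<close>
  is a unit there.\<close>

definition \<Phi> :: "rat \<Rightarrow> nat \<Rightarrow> rat mat \<Rightarrow> rat mat" where
  "\<Phi> t r X = inv\<^bsub>M2\<^esub> (Amat t r) * X * Amat t r"

lemma mat2_carrier [simp]: "mat2 a b c d \<in> carrier_mat 2 2"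
  by (simp add: mat2_def mat_of_rows_list_def numeral_2_eq_2)

lemma mat2_dim: "dim_row (mat2 a b c d) = 2" "dim_col (mat2 a b c d) = 2"
  by (simp_all add: mat2_def mat_of_rows_list_def numeral_2_eq_2)

lemma mat2_index [simp]:
  "mat2 a b c d $$ (0, 0) = a" "mat2 a b c d $$ (0, Suc 0) = b"
  "mat2 a b c d $$ (Suc 0, 0) = c" "mat2 a b c d $$ (Suc 0, Suc 0) = d"
  by (simp_all add: mat2_def mat_of_rows_list_def numeral_2_eq_2)

lemma mat2_eqI:
  assumes "X \<in> carrier_mat 2 2"
  shows "X = mat2 (X $$ (0, 0)) (X $$ (0, Suc 0)) (X $$ (Suc 0, 0)) (X $$ (Suc 0, Suc 0))"
  using assms
  by (intro eq_matI) (auto simp: mat2_dim numeral_2_eq_2 less_Suc_eq)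

lemma mat2_eq_iff: "mat2 a b c d = mat2 a' b' c' d' \<longleftrightarrow> a = a' \<and> b = b' \<and> c = c' \<and> d = d'"
  by (metis mat2_index)

lemma mat2_mult:
  "mat2 a b c d * mat2 a' b' c' d'
    = mat2 (a * a' + b * c') (a * b' + b * d') (c * a' + d * c') (c * b' + d * d')"
  by (intro eq_matI)
    (auto simp: mat2_dim numeral_2_eq_2 less_Suc_eq scalar_prod_def row_def col_def)

lemma mat2_one: "1\<^sub>m 2 = mat2 1 0 0 1"
  using mat2_eqI[of "1\<^sub>m 2"] by simp

lemma carrier_Rring: "carrier (Rring t) = {seq_mat t x0 x1 | x0 x1. True}"
proof (rule equalityI; rule subsetI)
  fix X assume "X \<in> carrier (Rring t)"
  then have X: "X \<in> carrier_mat 2 2" and comm: "X * Dmat t = Dmat t * X"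
    by (auto simp: Rring_def ring_mat_simps)
  obtain a b c d where abcd: "X = mat2 a b c d"
    using mat2_eqI[OF X] by blast
  have "X = seq_mat t c d"
    using comm by (auto simp: abcd Dmat_def seq_mat_def mat2_mult mat2_eq_iff algebra_simps)
  then show "X \<in> {seq_mat t x0 x1 | x0 x1. True}" by blast
next
  fix X assume "X \<in> {seq_mat t x0 x1 | x0 x1. True}"
  then show "X \<in> carrier (Rring t)"
    by (auto simp: Rring_def ring_mat_simps Dmat_def seq_mat_def mat2_mult mat2_eq_iff algebra_simps)
qed

lemma ring_Rring: "ring (Rring t)"
proof -
  interpret M: ring M2 by (rule ring_mat)
  have D: "Dmat t \<in> carrier M2" by (simp add: Dmat_def ring_mat_simps)
  have "subring {X \<in> carrier M2. X \<otimes>\<^bsub>M2\<^esub> Dmat t = Dmat t \<otimes>\<^bsub>M2\<^esub> X} M2"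
  proof (rule M.subringI, goal_cases)
    case (4 h1 h2)
    then show ?case using D by (simp) (metis M.m_assoc)
  qed (use D in \<open>auto simp: M.l_minus M.r_minus M.l_distr M.r_distr\<close>)
  from M.subring_is_ring[OF this] show ?thesis
    by (simp add: Rring_def ring_mat_simps)
qed

lemma Dmat_Units: "Dmat t \<in> Units M2"
  unfolding Units_def
  by (auto simp: ring_mat_simps Dmat_def mat2_mult mat2_one mat2_eq_iff intro!: bexI[of _ "mat2 t 1 (-1) 0"])

lemma represents_unique:
  assumes "X \<in> carrier (Rring t)"
  shows "\<exists>!x. represents t X x"
proof -
  obtain a b where X: "X = seq_mat t a b" using assms carrier_Rring by auto
  define f where "f a b n = fst (((\<lambda>(u, v). (v, t * v - u)) ^^ n) (a, b))" for a b :: rat and n :: nat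
  have snd_f: "snd (((\<lambda>(u, v). (v, t * v - u)) ^^ n) (a, b)) = f a b (Suc n)" for a b n
    by (simp add: f_def case_prod_beta)
  have f0: "f a b 0 = a" "f a b (Suc 0) = b" for a b by (simp_all add: f_def)
  have fS: "f a b (Suc (Suc n)) = t * f a b (Suc n) - f a b n" for a b n
    by (simp add: f_def case_prod_beta)
  define x where "x n = (if n \<ge> 0 then f a b (nat n) else f b a (nat (1 - n)))" for n
  have rec: "x (n + 1) = t * x n - x (n - 1)" for n
  proof -
    have "(\<exists>m. n = 1 + int m) \<or> n = 0 \<or> (\<exists>m. n = - 1 - int m)"
      by presburger
    then consider (1) m where "n = 1 + int m" | (2) "n = 0" | (3) m where "n = - 1 - int m"
      by blast
    then show ?thesis
    proof cases
      case (1 m)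
      have "nat (n + 1) = Suc (Suc m)" "nat n = Suc m" "nat (n - 1) = m" using 1 by auto
      then show ?thesis using 1 by (simp add: x_def fS)
    next
      case 2
      have "nat 2 = Suc (Suc 0)" by simp
      then show ?thesis using 2 by (simp add: x_def f0 fS del: nat_numeral)
    next
      case (3 m)
      have n: "nat (1 - n) = Suc (Suc m)" "nat (1 - (n - 1)) = Suc (Suc (Suc m))"
        using 3 by auto
      have "x (n + 1) = f b a (Suc m)"
        using 3 by (cases m) (auto simp: x_def f0 nat_add_distrib)
      moreover have "x n = f b a (Suc (Suc m))" "x (n - 1) = f b a (Suc (Suc (Suc m)))"
        using 3 n by (auto simp: x_def simp del: nat_diff_distrib)
      ultimately show ?thesis by (simp add: fS)
    qed
  qed
  have "represents t X x"
    using rec by (simp add: represents_def X x_def f0)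
  moreover have "y = x" if y: "represents t X y" for y
  proof -
    have yrec: "y (n + 1) = t * y n - y (n - 1)" for n
      using y by (simp add: represents_def)
    have init: "y 0 = x 0" "y 1 = x 1"
      using y \<open>represents t X x\<close> by (auto simp: represents_def seq_mat_def mat2_eq_iff)
    have "y n = x n \<and> y (n + 1) = x (n + 1)" for n
    proof (induction n rule: int_induct[where k = 0])
      case base then show ?case using init by simp
    next
      case (step1 i)
      then show ?case using yrec[of "i + 1"] rec[of "i + 1"] by simp
    next
      case (step2 i)
      have "y (i - 1) = t * y i - y (i + 1)" "x (i - 1) = t * x i - x (i + 1)"
        using yrec[of i] rec[of i] by simp_all
      then show ?case using step2 by simp
    qed
    then show ?thesis by auto
  qed
  ultimately show ?thesis by blast
qed

lemma Dmat_pow: "Dmat t [^]\<^bsub>M2\<^esub> Suc n = seq_mat t (chebU (Suc n) t) (chebU (Suc (Suc n)) t)"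
  by (induction n)
    (auto simp: nat_pow_def ring_mat_simps Dmat_def seq_mat_def mat2_mult mat2_one mat2_eq_iff algebra_simps)

lemma chebC_rec:
  "chebC 0 t = 2" "chebC (Suc 0) t = t" "chebC (Suc (Suc n)) t = t * chebC (Suc n) t - chebC n t"
proof -
  have tr: "(\<Sum>i<2. mat2 a b c d $$ (i, i)) = a + d" for a b c d
    by (simp add: numeral_2_eq_2)
  have CS: "chebC (Suc n) t = 2 * chebU (Suc (Suc n)) t - t * chebU (Suc n) t" for n
    unfolding chebC_def Dmat_pow seq_mat_def tr by simp
  show C0: "chebC 0 t = 2"
    by (simp add: chebC_def ring_mat_simps mat2_one tr)
  show "chebC (Suc 0) t = t" by (simp add: CS)
  show "chebC (Suc (Suc n)) t = t * chebC (Suc n) t - chebC n t"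
    by (cases n) (simp_all add: CS C0 algebra_simps)
qed

end

theory Submission
  imports Defs "HOL-Number_Theory.Cong"
begin

text \<open>
  Everything rests on \<open>U\<^sub>r(t) \<noteq> 0\<close> for rational \<open>t \<noteq> 0, \<plusminus>1\<close>, which is what makes \<open>A\<close> invertible.
  The roots of the \<open>U\<^sub>r\<close> are sums \<open>\<zeta> + \<zeta>\<^sup>-\<^sup>1\<close> with \<open>\<zeta> \<noteq> \<plusminus>1\<close> a root of unity: algebraic integers of
  absolute value below 2, so the only candidates among the rationals are \<open>0\<close> and \<open>\<plusminus>1\<close>. The proof
  below makes this elementary. A non-integral \<open>t = p/q\<close> is excluded because \<open>U\<^sub>r\<close> is monic with
  integer coefficients, so that \<open>q\<^sup>r\<^sup>-\<^sup>1 U\<^sub>r(t)\<close> is an integer congruent to \<open>p\<^sup>r\<^sup>-\<^sup>1\<close> modulo \<open>q\<close>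
  (\<open>chebU_denominator_cong\<close>); an integer \<open>t\<close> with \<open>\<bar>t\<bar> \<ge> 2\<close> is excluded because then
  \<open>\<bar>U\<^sub>n(t)\<bar>\<close> increases with \<open>n\<close> (\<open>abs_chebU_strict_mono\<close>).

  The rest is a computation with one conceptual point. Every solution of the recurrence satisfies
  \<open>x\<^sub>r = U\<^sub>r x\<^sub>1 - U\<^sub>r\<^sub>-\<^sub>1 x\<^sub>0\<close>, and the subsequence \<open>x\<^sub>0, x\<^sub>r, x\<^sub>2\<^sub>r, \<dots>\<close> satisfies the recurrence with
  parameter \<open>C\<^sub>r(t)\<close>. Multiplication of row vectors by \<open>A\<close> sends \<open>(x\<^sub>0, x\<^sub>1)\<close> to \<open>(x\<^sub>0, x\<^sub>r)\<close>, and
  conjugation by it sends the sequence with initial values \<open>x\<^sub>0, x\<^sub>1\<close> to the one with initial values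
  \<open>x\<^sub>0/U\<^sub>r, x\<^sub>r/U\<^sub>r\<close> (\<open>\<Phi>_seq_mat\<close>). In the matrix identity the recurrence enters only through
  \<open>C\<^sub>r = t U\<^sub>r - 2 U\<^sub>r\<^sub>-\<^sub>1\<close> and \<open>U\<^sub>r\<^sup>2 - t U\<^sub>r U\<^sub>r\<^sub>-\<^sub>1 + U\<^sub>r\<^sub>-\<^sub>1\<^sup>2 = 1\<close>. Since \<open>(x\<^sub>0, x\<^sub>1) \<mapsto> (x\<^sub>0/U\<^sub>r, x\<^sub>r/U\<^sub>r)\<close>
  is a linear bijection, \<open>\<Phi>\<close> is a ring isomorphism, and the statements on powers follow because
  conjugation respects products and inverses.
\<close>

section \<open>Rational zeros of the Chebyshev polynomials of the second kind\<close>

text \<open>The polynomial \<open>U\<^sub>n\<^sub>+\<^sub>1\<close> is monic of degree \<open>n\<close> with integer coefficients; multiplying its value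
  at \<open>p/q\<close> by \<open>q\<^sup>n\<close> leaves the leading term \<open>p\<^sup>n\<close> and multiples of \<open>q\<close>.\<close>

lemma chebU_denominator_cong:
  fixes p q :: int
  assumes "q \<noteq> 0"
  shows "\<exists>v. rat_of_int v = of_int q ^ n * chebU (Suc n) (of_int p / of_int q) \<and> [v = p ^ n] (mod q)"
proof (induction n rule: induct_nat_012)
  case 0
  show ?case by (intro exI[of _ 1]) simp
next
  case 1
  show ?case using assms by (intro exI[of _ p]) simp
next
  case (ge2 n)
  let ?U = "\<lambda>n. chebU n (of_int p / of_int q)"
  obtain v w where v: "rat_of_int v = of_int q ^ n * ?U (Suc n)"
    and w: "rat_of_int w = of_int q ^ Suc n * ?U (Suc (Suc n))" "[w = p ^ Suc n] (mod q)"
    using ge2 by blast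
  have "rat_of_int (p * w - q\<^sup>2 * v) = of_int q ^ Suc (Suc n) * ?U (Suc (Suc (Suc n)))"
    using assms by (simp add: v w(1) power2_eq_square field_simps)
  moreover have "[p * w - q\<^sup>2 * v = p * p ^ Suc n - 0] (mod q)"
    by (intro cong_diff cong_mult cong_refl w(2)) (simp add: cong_0_iff power2_eq_square)
  ultimately show ?case by (intro exI[of _ "p * w - q\<^sup>2 * v"]) simp
qed

lemma chebU_nonzero_if_not_integer:
  assumes "t \<notin> \<int>"
  shows "chebU (Suc n) t \<noteq> 0"
proof
  assume zero: "chebU (Suc n) t = 0"
  obtain p q where pq: "quotient_of t = (p, q)" by fastforce
  have q: "q > 0" and t: "t = of_int p / of_int q" and cop: "coprime p q"
    using quotient_of_denom_pos[OF pq] quotient_of_div[OF pq] quotient_of_coprime[OF pq] by auto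
  obtain v where "rat_of_int v = of_int q ^ n * chebU (Suc n) t" "[v = p ^ n] (mod q)"
    using chebU_denominator_cong[of q n p] q t by auto
  with zero have "q dvd p ^ n"
    by (simp add: cong_sym_eq[of 0] cong_0_iff)
  moreover have "coprime (p ^ n) q" using cop by simp
  ultimately have "is_unit q" by (metis coprime_common_divisor dvd_refl)
  with q t assms show False by simp
qed

lemma abs_chebU_strict_mono:
  assumes "\<bar>t\<bar> \<ge> 2"
  shows "\<bar>chebU n t\<bar> < \<bar>chebU (Suc n) t\<bar>"
proof (induction n)
  case (Suc n)
  have "2 * \<bar>chebU (Suc n) t\<bar> \<le> \<bar>t * chebU (Suc n) t\<bar>"
    using assms by (simp add: abs_mult mult_right_mono)
  with Suc show ?case by simp
qed simp

lemma chebU_nonzero: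
  assumes "t \<noteq> 0" "t \<noteq> 1" "t \<noteq> -1"
  shows "chebU (Suc n) t \<noteq> 0"
proof (cases "t \<in> \<int>")
  case True
  then obtain m where m: "t = of_int m" by (auto elim: Ints_cases)
  with assms have "m \<noteq> 0" "m \<noteq> 1" "m \<noteq> -1" by auto
  then have "\<bar>m\<bar> \<ge> 2" by arith
  with m have "\<bar>t\<bar> \<ge> 2" by (metis of_int_abs of_int_le_iff of_int_numeral)
  from abs_chebU_strict_mono[OF this, of n] show ?thesis by auto
qed (rule chebU_nonzero_if_not_integer)

section \<open>Identities for Chebyshev polynomials and linear recurrences\<close>

text \<open>The quadratic form \<open>x\<^sup>2 - t x y + y\<^sup>2\<close> is invariant under \<open>(x, y) \<mapsto> (t x - y, x)\<close>; equivalently,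
  \<open>det D\<^sub>t\<^sup>n = 1\<close>.\<close>

lemma chebU_Cassini: "(chebU (Suc n) t)\<^sup>2 - t * chebU (Suc n) t * chebU n t + (chebU n t)\<^sup>2 = 1"
  by (induction n) (simp_all add: power2_eq_square algebra_simps)

lemma chebC_Suc: "chebC (Suc n) t = t * chebU (Suc n) t - 2 * chebU n t"
proof (induction n rule: induct_nat_012)
  case (ge2 n)
  have "chebC (Suc (Suc (Suc n))) t = t * chebC (Suc (Suc n)) t - chebC (Suc n) t"
    by (rule chebC_rec(3))
  then show ?case unfolding ge2 by (simp add: algebra_simps)
qed (simp_all add: chebC_rec)

lemma represents_Suc:
  assumes "represents t X x"
  shows "x (int (Suc n)) = chebU (Suc n) t * x 1 - chebU n t * x 0"
proof (induction n rule: induct_nat_012)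
  case 1
  have "x (1 + 1) = t * x 1 - x (1 - 1)"
    using assms unfolding represents_def by blast
  then show ?case by simp
next
  case (ge2 n)
  have "x (int (Suc (Suc n)) + 1) = t * x (int (Suc (Suc n))) - x (int (Suc (Suc n)) - 1)"
    using assms unfolding represents_def by blast
  moreover have "int (Suc (Suc n)) + 1 = int (Suc (Suc (Suc n)))"
    and "int (Suc (Suc n)) - 1 = int (Suc n)"
    by simp_all
  ultimately have "x (int (Suc (Suc (Suc n)))) = t * x (int (Suc (Suc n))) - x (int (Suc n))"
    by simp
  with ge2 show ?case by (simp only: chebU.simps) (simp add: algebra_simps)
qed simp

section \<open>Conjugation and powers in a monoid\<close>

context monoid
begin

text \<open>The powers of \<open>x\<close> stay in the group of units, so the power law of groups survives. The case
  \<open>k < 0\<close>, \<open>n = 0\<close> stands apart: there the exponent on the left is not negative while the one on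
  the right is.\<close>

lemma Units_int_pow_mult:
  assumes "x \<in> Units G"
  shows "x [^] (k * int n) = (x [^] n) [^] (k :: int)"
proof -
  have x: "x \<in> carrier G" using assms by (rule Units_closed)
  have "nat (\<bar>k\<bar> * int n) = n * nat \<bar>k\<bar>" by (simp add: nat_mult_distrib)
  then have pow: "x [^] nat (\<bar>k\<bar> * int n) = (x [^] n) [^] nat \<bar>k\<bar>"
    using x by (simp add: nat_pow_pow del: pow_nat)
  consider "k \<ge> 0" | "k < 0" "n = 0" | "k < 0" "n > 0" by linarith
  then show ?thesis
  proof cases
    case 1
    moreover have "\<not> k * int n < 0" using 1 by (simp add: not_less)
    ultimately show ?thesis using pow by (simp add: int_pow_def2 del: pow_nat)
  next
    case 2
    then show ?thesis by (simp add: int_pow_def2 del: pow_nat)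
  next
    case 3
    then have "k * int n < 0" by (simp add: mult_neg_pos)
    with 3 pow show ?thesis by (simp add: int_pow_def2 del: pow_nat)
  qed
qed

lemma conj_mult:
  assumes "a \<in> Units G" "x \<in> carrier G" "y \<in> carrier G"
  shows "inv a \<otimes> (x \<otimes> y) \<otimes> a = (inv a \<otimes> x \<otimes> a) \<otimes> (inv a \<otimes> y \<otimes> a)"
proof -
  have "(inv a \<otimes> x \<otimes> a) \<otimes> (inv a \<otimes> y \<otimes> a) = inv a \<otimes> x \<otimes> (a \<otimes> inv a) \<otimes> y \<otimes> a"
    using assms by (simp add: m_assoc Units_closed del: Units_r_inv)
  then show ?thesis using assms by (simp add: m_assoc Units_closed)
qed

lemma conj_nat_pow:
  assumes "a \<in> Units G" "x \<in> carrier G"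
  shows "inv a \<otimes> (x [^] (n :: nat)) \<otimes> a = (inv a \<otimes> x \<otimes> a) [^] n"
  by (induction n) (use assms in \<open>simp_all add: conj_mult\<close>)

lemma conj_inv:
  assumes "a \<in> Units G" "x \<in> Units G"
  shows "inv a \<otimes> inv x \<otimes> a = inv (inv a \<otimes> x \<otimes> a)"
proof (rule inv_unique')
  have x: "x \<in> carrier G" using assms(2) by (rule Units_closed)
  have ix: "inv x \<in> carrier G" using assms(2) by (rule Units_inv_closed)
  have a: "a \<in> carrier G" using assms(1) by (rule Units_closed)
  have ia: "inv a \<in> carrier G" using assms(1) by (rule Units_inv_closed)
  show "inv a \<otimes> x \<otimes> a \<in> carrier G" "inv a \<otimes> inv x \<otimes> a \<in> carrier G"
    using a ia x ix by simp_all
  show "(inv a \<otimes> x \<otimes> a) \<otimes> (inv a \<otimes> inv x \<otimes> a) = \<one>"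
    unfolding conj_mult[OF assms(1) x ix, symmetric] Units_r_inv[OF assms(2)]
    using assms(1) ia by simp
  show "(inv a \<otimes> inv x \<otimes> a) \<otimes> (inv a \<otimes> x \<otimes> a) = \<one>"
    unfolding conj_mult[OF assms(1) ix x, symmetric] Units_l_inv[OF assms(2)]
    using assms(1) ia by simp
qed

lemma conj_int_pow:
  assumes "a \<in> Units G" "x \<in> Units G"
  shows "inv a \<otimes> (x [^] (k :: int)) \<otimes> a = (inv a \<otimes> x \<otimes> a) [^] k"
  using assms by (simp add: int_pow_def2 conj_nat_pow conj_inv Units_closed Units_pow_closed del: pow_nat)

lemma Units_int_pow_closed:
  assumes "x \<in> Units G"
  shows "x [^] (k :: int) \<in> carrier G"
  using assms by (simp add: int_pow_def2 Units_closed Units_pow_closed del: pow_nat)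

end

section \<open>The isomorphism\<close>

interpretation M2: ring M2
  rewrites "mult M2 = (*)" and "add M2 = (+)" and "one M2 = 1\<^sub>m 2" and "carrier M2 = carrier_mat 2 2"
  by (rule ring_mat) (simp_all add: ring_mat_simps)

lemma seq_mat_eq_iff: "seq_mat t a b = seq_mat t c d \<longleftrightarrow> a = c \<and> b = d"
  by (auto simp: seq_mat_def mat2_eq_iff)

context
  fixes t :: rat and n :: nat
  assumes U_nonzero: "chebU (Suc n) t \<noteq> 0"
begin

lemma Amat_inverse:
  shows Amat_Units: "Amat t (Suc n) \<in> Units M2"
    and inv_Amat: "inv\<^bsub>M2\<^esub> (Amat t (Suc n))
      = mat2 1 (chebU n t / chebU (Suc n) t) 0 (1 / chebU (Suc n) t)"
proof -
  let ?B = "mat2 1 (chebU n t / chebU (Suc n) t) 0 (1 / chebU (Suc n) t)"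
  have inverse: "Amat t (Suc n) * ?B = 1\<^sub>m 2" "?B * Amat t (Suc n) = 1\<^sub>m 2"
    and carrier: "Amat t (Suc n) \<in> carrier_mat 2 2"
    using U_nonzero by (simp_all add: Amat_def mat2_mult mat2_one mat2_eq_iff)
  show "Amat t (Suc n) \<in> Units M2"
    using inverse carrier by (auto simp: Units_def ring_mat_simps intro!: bexI[of _ ?B])
  show "inv\<^bsub>M2\<^esub> (Amat t (Suc n)) = ?B"
    using M2.inv_unique'[OF carrier mat2_carrier inverse] by simp
qed

text \<open>The new initial values are \<open>x\<^sub>0/U\<^sub>r\<close> and \<open>x\<^sub>r/U\<^sub>r\<close>. The entries on the diagonal agree by the
  formula for \<open>C\<^sub>r\<close>, the upper right one by the Cassini identity.\<close>

lemma \<Phi>_seq_mat: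
  "\<Phi> t (Suc n) (seq_mat t a b)
    = seq_mat (chebC (Suc n) t) (a / chebU (Suc n) t)
        ((chebU (Suc n) t * b - chebU n t * a) / chebU (Suc n) t)"
proof -
  define u v where "u = chebU (Suc n) t" and "v = chebU n t"
  have u: "u \<noteq> 0" using U_nonzero by (simp add: u_def)
  have cassini: "t * u * v - u * u - v * v = - 1"
    using chebU_Cassini[of n t] by (simp add: u_def v_def power2_eq_square algebra_simps)
  have upper_right: "(1 * (b - t * a) + v / u * a) * (- v) + (1 * (- a) + v / u * b) * u = - (a / u)"
    (is "?e = _")
  proof -
    have "?e = a * (t * u * v - u * u - v * v) / u"
      using u by (simp add: field_simps)
    then show ?thesis by (simp add: cassini)
  qed
  have "\<Phi> t (Suc n) (seq_mat t a b)
      = mat2 1 (v / u) 0 (1 / u) * mat2 (b - t * a) (- a) a b * mat2 1 (- v) 0 u"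
    unfolding \<Phi>_def inv_Amat by (simp add: seq_mat_def Amat_def u_def v_def)
  also have "\<dots> = seq_mat (t * u - 2 * v) (a / u) ((u * b - v * a) / u)"
    unfolding mat2_mult seq_mat_def mat2_eq_iff
    by (intro conjI upper_right) (use u in \<open>simp_all add: field_simps\<close>)
  finally show ?thesis by (simp add: u_def v_def chebC_Suc)
qed

lemma \<Phi>_bij_betw:
  "bij_betw (\<Phi> t (Suc n)) (carrier (Rring t)) (carrier (Rring (chebC (Suc n) t)))"
proof (rule bij_betwI')
  fix X Y assume "X \<in> carrier (Rring t)" "Y \<in> carrier (Rring t)"
  then show "\<Phi> t (Suc n) X = \<Phi> t (Suc n) Y \<longleftrightarrow> X = Y"
    using U_nonzero by (auto simp: carrier_Rring \<Phi>_seq_mat seq_mat_eq_iff)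
next
  fix X assume "X \<in> carrier (Rring t)"
  then show "\<Phi> t (Suc n) X \<in> carrier (Rring (chebC (Suc n) t))"
    by (fastforce simp: carrier_Rring \<Phi>_seq_mat)
next
  fix Y assume "Y \<in> carrier (Rring (chebC (Suc n) t))"
  then obtain c d where "Y = seq_mat (chebC (Suc n) t) c d"
    by (auto simp: carrier_Rring)
  (* Preimage: x_0 = U_r c, and x_1 = d + U_{r-1} c solves x_r = U_r x_1 - U_{r-1} x_0 = U_r d. *)
  then have "Y = \<Phi> t (Suc n) (seq_mat t (chebU (Suc n) t * c) (d + chebU n t * c))"
    using U_nonzero by (simp add: \<Phi>_seq_mat seq_mat_eq_iff field_simps)
  then show "\<exists>X \<in> carrier (Rring t). Y = \<Phi> t (Suc n) X"
    by (auto simp: carrier_Rring)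
qed

lemma \<Phi>_mult:
  assumes "X \<in> carrier_mat 2 2" "Y \<in> carrier_mat 2 2"
  shows "\<Phi> t (Suc n) (X * Y) = \<Phi> t (Suc n) X * \<Phi> t (Suc n) Y"
  unfolding \<Phi>_def by (rule M2.conj_mult[OF Amat_Units assms])

lemma \<Phi>_ring_iso: "\<Phi> t (Suc n) \<in> ring_iso (Rring t) (Rring (chebC (Suc n) t))"
proof -
  have A: "Amat t (Suc n) \<in> carrier_mat 2 2" "inv\<^bsub>M2\<^esub> (Amat t (Suc n)) \<in> carrier_mat 2 2"
    using Amat_Units by auto
  have carrier: "X \<in> carrier_mat 2 2" if "X \<in> carrier (Rring t)" for X
    using that by (auto simp: carrier_Rring seq_mat_def)
  show ?thesis
    unfolding ring_iso_def
  proof (intro CollectI conjI ring_hom_memI \<Phi>_bij_betw)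
    fix X assume "X \<in> carrier (Rring t)"
    then show "\<Phi> t (Suc n) X \<in> carrier (Rring (chebC (Suc n) t))"
      using \<Phi>_bij_betw bij_betwE by blast
  next
    fix X Y assume "X \<in> carrier (Rring t)" "Y \<in> carrier (Rring t)"
    then have X: "X \<in> carrier_mat 2 2" and Y: "Y \<in> carrier_mat 2 2" by (auto dest: carrier)
    from \<Phi>_mult[OF X Y]
    show "\<Phi> t (Suc n) (X \<otimes>\<^bsub>Rring t\<^esub> Y)
        = \<Phi> t (Suc n) X \<otimes>\<^bsub>Rring (chebC (Suc n) t)\<^esub> \<Phi> t (Suc n) Y"
      by (simp add: Rring_def ring_mat_simps)
    have "\<Phi> t (Suc n) (X + Y) = \<Phi> t (Suc n) X + \<Phi> t (Suc n) Y"
      using X Y A by (simp add: \<Phi>_def M2.l_distr M2.r_distr)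
    then show "\<Phi> t (Suc n) (X \<oplus>\<^bsub>Rring t\<^esub> Y)
        = \<Phi> t (Suc n) X \<oplus>\<^bsub>Rring (chebC (Suc n) t)\<^esub> \<Phi> t (Suc n) Y"
      by (simp add: Rring_def ring_mat_simps)
  next
    show "\<Phi> t (Suc n) \<one>\<^bsub>Rring t\<^esub> = \<one>\<^bsub>Rring (chebC (Suc n) t)\<^esub>"
      using A(2) M2.Units_l_inv[OF Amat_Units] by (simp add: Rring_def ring_mat_simps \<Phi>_def)
  qed
qed

lemma \<Phi>_represents:
  assumes "represents t X x"
  shows "chebU (Suc n) t \<cdot>\<^sub>m \<Phi> t (Suc n) X
    = mat2 (x (int (Suc n)) - chebC (Suc n) t * x 0) (- x 0) (x 0) (x (int (Suc n)))"
proof -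
  have smult: "c \<cdot>\<^sub>m mat2 p q r s = mat2 (c * p) (c * q) (c * r) (c * s)" for c p q r s
    by (subst mat2_eqI[of "c \<cdot>\<^sub>m mat2 p q r s"]) (simp_all add: mat2_dim)
  have "X = seq_mat t (x 0) (x 1)" using assms by (simp add: represents_def)
  then have "\<Phi> t (Suc n) X
      = seq_mat (chebC (Suc n) t) (x 0 / chebU (Suc n) t) (x (int (Suc n)) / chebU (Suc n) t)"
    by (simp only: \<Phi>_seq_mat represents_Suc[OF assms])
  then show ?thesis
    using U_nonzero
    by (simp add: seq_mat_def smult mat2_eq_iff right_diff_distrib del: of_nat_Suc)
qed

lemma \<Phi>_Dmat_pow: "\<Phi> t (Suc n) (Dmat t [^]\<^bsub>M2\<^esub> Suc n) = Dmat (chebC (Suc n) t)"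
  unfolding Dmat_pow \<Phi>_seq_mat
  using U_nonzero by (simp add: Dmat_def seq_mat_def mat2_eq_iff chebC_Suc field_simps)

lemma \<Phi>_mult_Dmat_int_pow:
  assumes "X \<in> carrier_mat 2 2"
  shows "\<Phi> t (Suc n) (X * (Dmat t [^]\<^bsub>M2\<^esub> (k * int (Suc n))))
    = \<Phi> t (Suc n) X * (Dmat (chebC (Suc n) t) [^]\<^bsub>M2\<^esub> (k :: int))"
proof -
  have unit: "Dmat t [^]\<^bsub>M2\<^esub> Suc n \<in> Units M2"
    by (rule M2.Units_pow_closed[OF Dmat_Units])
  have "\<Phi> t (Suc n) (Dmat t [^]\<^bsub>M2\<^esub> (k * int (Suc n)))
      = \<Phi> t (Suc n) (Dmat t [^]\<^bsub>M2\<^esub> Suc n) [^]\<^bsub>M2\<^esub> k"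
    unfolding M2.Units_int_pow_mult[OF Dmat_Units] \<Phi>_def
    by (rule M2.conj_int_pow[OF Amat_Units unit])
  then show ?thesis
    by (simp only: \<Phi>_mult[OF assms M2.Units_int_pow_closed[OF Dmat_Units]] \<Phi>_Dmat_pow)
qed

end

theorem proposition5:
  fixes t :: rat and r :: nat
  assumes "t \<noteq> 0" "t \<noteq> 1" "t \<noteq> -1" "t \<noteq> 2" "t \<noteq> -2"
    and "r \<ge> 1"
  shows "Amat t r \<in> Units M2
    \<and> \<Phi> t r \<in> ring_iso (Rring t) (Rring (chebC r t))
    \<and> (\<forall>X \<in> carrier (Rring t). \<forall>x :: int \<Rightarrow> rat. represents t X x \<longrightarrow>
          chebU r t \<cdot>\<^sub>m \<Phi> t r X
            = mat2 (x (int r) - chebC r t * x 0) (- x 0) (x 0) (x (int r)))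
    \<and> \<Phi> t r (Dmat t [^]\<^bsub>M2\<^esub> r) = Dmat (chebC r t)
    \<and> (\<forall>X \<in> carrier (Rring t). \<forall>k :: int.
          \<Phi> t r (X * (Dmat t [^]\<^bsub>M2\<^esub> (k * int r))) = \<Phi> t r X * (Dmat (chebC r t) [^]\<^bsub>M2\<^esub> k))"
proof -
  obtain n where r: "r = Suc n" using assms(6) by (cases r) auto
  have U: "chebU (Suc n) t \<noteq> 0" by (rule chebU_nonzero[OF assms(1-3)])
  have carrier: "X \<in> carrier_mat 2 2" if "X \<in> carrier (Rring t)" for X
    using that by (auto simp: carrier_Rring seq_mat_def)
  show ?thesis
    unfolding r
    using Amat_Units[OF U] \<Phi>_ring_iso[OF U] \<Phi>_represents[OF U] \<Phi>_Dmat_pow[OF U]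
      \<Phi>_mult_Dmat_int_pow[OF U] carrier
    by blast
qed

end
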